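(* Let $\Psi:\mathcal{M}\times A\to\mathbb{R}$ be a Kempf-Ness function for $(\mathcal{M},A,\{e\})$ and let $\mathfrak{F}:\mathcal{M}\to\mathfrak{a}$ be the corresponding gradient map. Let $x\in\mathcal{M}$ and let $A_x=\exp(\mathfrak{a}_x)$ be the stabilizer of $x$ in $A$. Let $\pi:\mathfrak{a}\to\mathfrak{a}_x^\perp$ be the orthogonal projection. Then $\pi(\mathfrak{F}(A\cdot x))$ is an open convex subset of $\mathfrak{a}_x^\perp$. Moreover, $\mathfrak{F}(A\cdot x)$ is an open convex subset of the affine subspace $\mathfrak{F}(x)+\mathfrak{a}_x^\perp$ of $\mathfrak{a}$.
   Context: $G$ is a non-compact real reductive Lie group with Cartan decomposition $G=K\exp(\mathfrak{p})$, where $K$ is a maximal compact subgroup and $(k,\xi)\mapsto k\exp(\xi)$ is a diffeomorphism $K\times\mathfrak{p}\to G$. $\mathcal{M}$ is a Hausdorff topological space on which $G$ acts continuously. $\mathfrak{a}\subset\mathfrak{p}$ is an abelian subalgebra and $A=\exp(\mathfrak{a})\subset G$, so $\exp:\mathfrak{a}\to A$ is an isomorphism of Lie groups. A $K$-invariant scalar product $\langle\,,\,\rangle$ on $\mathfrak{p}$ is fixed; it restricts to $\mathfrak{a}$, orthogonal complements $\perp$ are taken in $\mathfrak{a}$, and $\mathfrak{a}^*\cong\mathfrak{a}$ via $\langle\,,\,\rangle$. For $x\in\mathcal{M}$, $A_x$ is its stabilizer in $A$ and $\mathfrak{a}_x$ is the Lie algebra of $A_x$. A Kempf-Ness function for $(\mathcal{M},A,\{e\})$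 is a function $\Psi:\mathcal{M}\times A\to\mathbb{R}$ such that: (P1) for every $x\in\mathcal{M}$, $\Psi(x,\cdot)$ is smooth on $A$; (P2) $\Psi(x,\cdot)$ is left-invariant under the maximal compact subgroup (here $\{e\}$, so this condition is void); (P3) for every $x\in\mathcal{M}$, $\xi\in\mathfrak{a}$, $t\in\mathbb{R}$, $\frac{d^2}{dt^2}\Psi(x,\exp(t\xi))\ge0$, and $\frac{d^2}{dt^2}\big|_{t=0}\Psi(x,\exp(t\xi))=0$ if and only if $\exp(\mathbb{R}\xi)\subset A_x$; (P4) (cocycle condition) $\Psi(x,g)+\Psi(gx,h)=\Psi(x,hg)$ for all $x\in\mathcal{M}$, $g,h\in A$; (P5) the map $\mathfrak{F}:\mathcal{M}\to\mathfrak{a}^*\cong\mathfrak{a}$ defined by $\langle\mathfrak{F}(x),\xi\rangle=\frac{d}{dt}\big|_{t=0}\Psi(x,\exp(t\xi))$ for $\xi\in\mathfrak{a}$ is continuous. The map $\mathfrak{F}$ is called the gradient map. *)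

theory Defs
  imports "HOL-Analysis.Analysis" "HOL-Algebra.Group_Action"
begin

section \<open>Smooth maps\<close>

text \<open>Meant for open sets \<open>S\<close>. In finite dimension, a differentiable map all of whose directional
  derivatives are \<open>C\<^sup>k\<close> is \<open>C\<^sup>k\<^sup>+\<^sup>1\<close>.\<close>

fun Ck_on :: "nat \<Rightarrow> 'a::euclidean_space set \<Rightarrow> ('a \<Rightarrow> 'b::real_normed_vector) \<Rightarrow> bool" where
  "Ck_on 0 S f \<longleftrightarrow> continuous_on S f"
| "Ck_on (Suc k) S f \<longleftrightarrow>
     f differentiable_on S \<and> (\<forall>v. Ck_on k S (\<lambda>x. frechet_derivative f (at x) v))"

definition smooth_on :: "'a::euclidean_space set \<Rightarrow> ('a \<Rightarrow> 'b::real_normed_vector) \<Rightarrow> bool" where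
  "smooth_on S f \<longleftrightarrow> (\<forall>k. Ck_on k S f)"

text \<open>Smoothness of a function on a linear subspace \<open>V\<close> (a closed submanifold), expressed by
  a smooth extension to the ambient space.\<close>

definition smooth_on_subspace ::
    "'a::euclidean_space set \<Rightarrow> ('a \<Rightarrow> 'b::real_normed_vector) \<Rightarrow> bool" where
  "smooth_on_subspace V f \<longleftrightarrow> (\<exists>g. smooth_on UNIV g \<and> (\<forall>v\<in>V. g v = f v))"

text \<open>A chart is a pair of its domain and its coordinate map.\<close>

type_synonym ('p, 'e) chart = "'p set \<times> ('p \<Rightarrow> 'e)"

definition smooth_atlas :: "'p topology \<Rightarrow> ('p, 'e::euclidean_space) chart set \<Rightarrow> bool" where
  "smooth_atlas T At \<longleftrightarrow>
     (\<Union>(U, \<phi>)\<in>At. U) = topspace T \<and>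
     (\<forall>(U, \<phi>)\<in>At. openin T U \<and> open (\<phi> ` U) \<and>
        homeomorphic_map (subtopology T U) (top_of_set (\<phi> ` U)) \<phi>) \<and>
     (\<forall>(U, \<phi>)\<in>At. \<forall>(V, \<psi>)\<in>At. smooth_on (\<phi> ` (U \<inter> V)) (\<psi> \<circ> inv_into U \<phi>))"

definition smooth_map ::
    "'p topology \<Rightarrow> ('p, 'd::euclidean_space) chart set \<Rightarrow>
     'q topology \<Rightarrow> ('q, 'e::euclidean_space) chart set \<Rightarrow> ('p \<Rightarrow> 'q) \<Rightarrow> bool" where
  "smooth_map T At T' At' f \<longleftrightarrow>
     continuous_map T T' f \<and>
     (\<forall>(U, \<phi>)\<in>At. \<forall>(V, \<psi>)\<in>At'. smooth_on (\<phi> ` (U \<inter> f -` V)) (\<psi> \<circ> f \<circ> inv_into U \<phi>))"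

definition prod_atlas ::
    "('p, 'd) chart set \<Rightarrow> ('q, 'e) chart set \<Rightarrow> ('p \<times> 'q, 'd \<times> 'e) chart set" where
  "prod_atlas At At' = {(U \<times> V, map_prod \<phi> \<psi>) | U \<phi> V \<psi>. (U, \<phi>) \<in> At \<and> (V, \<psi>) \<in> At'}"

definition std_atlas :: "('e, 'e) chart set" where
  "std_atlas = {(UNIV, id)}"


section \<open>Lie groups\<close>

text \<open>The field \<open>unit_chart\<close> is an auxiliary chart around the identity. It identifies the tangent
  space at the identity, that is the Lie algebra, with the model space \<open>'e\<close>. The standard inner
  product of \<open>'e\<close> has no meaning for the group and is not used.\<close>

record ('g, 'e) lie_data = "'g monoid" +
  gtop :: "'g topology"
  atlas :: "('g, 'e) chart set"
  unit_chart :: "('g, 'e) chart"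

definition lie_group :: "('g, 'e::euclidean_space) lie_data \<Rightarrow> bool" where
  "lie_group G \<longleftrightarrow>
     group G \<and> topspace (gtop G) = carrier G \<and>
     Hausdorff_space (gtop G) \<and> second_countable (gtop G) \<and>
     smooth_atlas (gtop G) (atlas G) \<and>
     smooth_map (prod_topology (gtop G) (gtop G)) (prod_atlas (atlas G) (atlas G))
       (gtop G) (atlas G) (\<lambda>(g, h). g \<otimes>\<^bsub>G\<^esub> h) \<and>
     smooth_map (gtop G) (atlas G) (gtop G) (atlas G) (\<lambda>g. inv\<^bsub>G\<^esub> g) \<and>
     unit_chart G \<in> atlas G \<and> \<one>\<^bsub>G\<^esub> \<in> fst (unit_chart G)"

definition one_parameter_subgroup ::
    "('g, 'e::euclidean_space) lie_data \<Rightarrow> 'e \<Rightarrow> (real \<Rightarrow> 'g) \<Rightarrow> bool" where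
  "one_parameter_subgroup G \<xi> \<gamma> \<longleftrightarrow>
     smooth_map euclidean std_atlas (gtop G) (atlas G) \<gamma> \<and>
     (\<forall>s t. \<gamma> (s + t) = \<gamma> s \<otimes>\<^bsub>G\<^esub> \<gamma> t) \<and>
     ((snd (unit_chart G) \<circ> \<gamma>) has_vector_derivative \<xi>) (at 0)"

definition lie_exp :: "('g, 'e::euclidean_space) lie_data \<Rightarrow> 'e \<Rightarrow> 'g" where
  "lie_exp G \<xi> = (THE \<gamma>. one_parameter_subgroup G \<xi> \<gamma>) 1"

definition Ad :: "('g, 'e::euclidean_space) lie_data \<Rightarrow> 'g \<Rightarrow> 'e \<Rightarrow> 'e" where
  "Ad G g \<xi> =
     vector_derivative
       (\<lambda>t. snd (unit_chart G) (g \<otimes>\<^bsub>G\<^esub> lie_exp G (t *\<^sub>R \<xi>) \<otimes>\<^bsub>G\<^esub> inv\<^bsub>G\<^esub> g)) (at 0)"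

definition lie_bracket :: "('g, 'e::euclidean_space) lie_data \<Rightarrow> 'e \<Rightarrow> 'e \<Rightarrow> 'e" where
  "lie_bracket G \<xi> \<eta> = vector_derivative (\<lambda>s. Ad G (lie_exp G (s *\<^sub>R \<xi>)) \<eta>) (at 0)"

text \<open>The Lie algebra of a closed subgroup \<open>H\<close> of the Lie subgroup with Lie algebra \<open>\<hh>\<close>.\<close>

definition lie_algebra_of ::
    "('g, 'e::euclidean_space) lie_data \<Rightarrow> 'e set \<Rightarrow> 'g set \<Rightarrow> 'e set" where
  "lie_algebra_of G \<hh> H = {\<xi>\<in>\<hh>. \<forall>t::real. lie_exp G (t *\<^sub>R \<xi>) \<in> H}"


section \<open>Real reductive groups\<close>

definition lie_ideal :: "('g, 'e::euclidean_space) lie_data \<Rightarrow> 'e set \<Rightarrow> bool" where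
  "lie_ideal G I \<longleftrightarrow> subspace I \<and> (\<forall>\<xi>. \<forall>\<eta>\<in>I. lie_bracket G \<xi> \<eta> \<in> I)"

definition reductive_lie_algebra :: "('g, 'e::euclidean_space) lie_data \<Rightarrow> bool" where
  "reductive_lie_algebra G \<longleftrightarrow>
     (\<forall>I. lie_ideal G I \<longrightarrow>
        (\<exists>J. lie_ideal G J \<and> I \<inter> J = {0} \<and> {\<xi> + \<eta> | \<xi> \<eta>. \<xi> \<in> I \<and> \<eta> \<in> J} = UNIV))"

definition symmetric_bilinear_on ::
    "'e::real_vector set \<Rightarrow> ('e \<Rightarrow> 'e \<Rightarrow> real) \<Rightarrow> bool" where
  "symmetric_bilinear_on V b \<longleftrightarrow>
     (\<forall>u\<in>V. \<forall>v\<in>V. b u v = b v u) \<and>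
     (\<forall>u\<in>V. \<forall>v\<in>V. \<forall>w\<in>V. b (u + v) w = b u w + b v w) \<and>
     (\<forall>c. \<forall>u\<in>V. \<forall>v\<in>V. b (c *\<^sub>R u) v = c * b u v)"

definition scalar_product_on ::
    "'e::real_vector set \<Rightarrow> ('e \<Rightarrow> 'e \<Rightarrow> real) \<Rightarrow> bool" where
  "scalar_product_on V b \<longleftrightarrow>
     symmetric_bilinear_on V b \<and> (\<forall>v\<in>V. v \<noteq> 0 \<longrightarrow> b v v > 0)"

definition maximal_compact_subgroup ::
    "('g, 'e::euclidean_space) lie_data \<Rightarrow> 'g set \<Rightarrow> bool" where
  "maximal_compact_subgroup G K \<longleftrightarrow>
     subgroup K G \<and> compactin (gtop G) K \<and>
     (\<forall>H. subgroup H G \<and> compactin (gtop G) H \<and> K \<subseteq> H \<longrightarrow> H = K)"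

text \<open>\<open>\<theta>\<close> is a Cartan involution with eigenspaces \<open>\<kk> = Lie(K)\<close> and \<open>\<pp>\<close>, compatible with an
  invariant form \<open>B\<close>.\<close>

definition cartan_involution ::
    "('g, 'e::euclidean_space) lie_data \<Rightarrow> 'g set \<Rightarrow> 'e set \<Rightarrow>
     ('e \<Rightarrow> 'e) \<Rightarrow> ('e \<Rightarrow> 'e \<Rightarrow> real) \<Rightarrow> bool" where
  "cartan_involution G K \<pp> \<theta> B \<longleftrightarrow>
     linear \<theta> \<and> (\<forall>\<xi>. \<theta> (\<theta> \<xi>) = \<xi>) \<and>
     (\<forall>\<xi> \<eta>. \<theta> (lie_bracket G \<xi> \<eta>) = lie_bracket G (\<theta> \<xi>) (\<theta> \<eta>)) \<and>
     {\<xi>. \<theta> \<xi> = \<xi>} = lie_algebra_of G UNIV K \<and>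
     {\<xi>. \<theta> \<xi> = - \<xi>} = \<pp> \<and>
     symmetric_bilinear_on UNIV B \<and>
     (\<forall>g\<in>carrier G. \<forall>\<xi> \<eta>. B (Ad G g \<xi>) (Ad G g \<eta>) = B \<xi> \<eta>) \<and>
     (\<forall>\<xi> \<eta>. B (\<theta> \<xi>) (\<theta> \<eta>) = B \<xi> \<eta>) \<and>
     (\<forall>\<xi>\<in>\<pp>. \<xi> \<noteq> 0 \<longrightarrow> B \<xi> \<xi> > 0) \<and>
     (\<forall>\<xi>\<in>lie_algebra_of G UNIV K. \<xi> \<noteq> 0 \<longrightarrow> B \<xi> \<xi> < 0)"

text \<open>The map \<open>(k, \<xi>) \<mapsto> k exp \<xi>\<close> is a diffeomorphism from \<open>K \<times> \<pp>\<close> onto \<open>G\<close>. Since \<open>K \<times> \<pp>\<close> is a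
  closed embedded submanifold of \<open>G \<times> \<gg>\<close>, its smoothness can be tested on \<open>G \<times> \<gg>\<close>, and that of the
  inverse on the two components, viewed as maps into \<open>G\<close> and \<open>\<gg>\<close>.\<close>

definition cartan_decomposition ::
    "('g, 'e::euclidean_space) lie_data \<Rightarrow> 'g set \<Rightarrow> 'e set \<Rightarrow> bool" where
  "cartan_decomposition G K \<pp> \<longleftrightarrow>
     (let \<mu> = (\<lambda>(g, \<xi>). g \<otimes>\<^bsub>G\<^esub> lie_exp G \<xi>) in
        bij_betw \<mu> (K \<times> \<pp>) (carrier G) \<and>
        smooth_map (prod_topology (gtop G) euclidean) (prod_atlas (atlas G) std_atlas)
          (gtop G) (atlas G) \<mu> \<and>
        smooth_map (gtop G) (atlas G) (gtop G) (atlas G) (fst \<circ> inv_into (K \<times> \<pp>) \<mu>) \<and>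
        smooth_map (gtop G) (atlas G) euclidean std_atlas (snd \<circ> inv_into (K \<times> \<pp>) \<mu>))"

definition real_reductive_group ::
    "('g, 'e::euclidean_space) lie_data \<Rightarrow> 'g set \<Rightarrow> 'e set \<Rightarrow> bool" where
  "real_reductive_group G K \<pp> \<longleftrightarrow>
     lie_group G \<and> reductive_lie_algebra G \<and> maximal_compact_subgroup G K \<and>
     (\<exists>\<theta> B. cartan_involution G K \<pp> \<theta> B) \<and> cartan_decomposition G K \<pp>"

definition invariant_scalar_product ::
    "('g, 'e::euclidean_space) lie_data \<Rightarrow> 'g set \<Rightarrow> 'e set \<Rightarrow> ('e \<Rightarrow> 'e \<Rightarrow> real) \<Rightarrow> bool" where
  "invariant_scalar_product G K \<pp> ip \<longleftrightarrow>
     scalar_product_on \<pp> ip \<and>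
     (\<forall>k\<in>K. \<forall>\<xi>\<in>\<pp>. \<forall>\<eta>\<in>\<pp>. ip (Ad G k \<xi>) (Ad G k \<eta>) = ip \<xi> \<eta>)"

definition abelian_subalgebra :: "('g, 'e::euclidean_space) lie_data \<Rightarrow> 'e set \<Rightarrow> bool" where
  "abelian_subalgebra G \<aa> \<longleftrightarrow> subspace \<aa> \<and> (\<forall>\<xi>\<in>\<aa>. \<forall>\<eta>\<in>\<aa>. lie_bracket G \<xi> \<eta> = 0)"

definition additive_group :: "'e::real_vector set \<Rightarrow> 'e monoid" where
  "additive_group V = \<lparr>carrier = V, mult = (+), one = 0\<rparr>"

text \<open>The group \<open>A = exp(\<aa>)\<close>, as a group in its own right.\<close>

definition exp_group ::
    "('g, 'e::euclidean_space) lie_data \<Rightarrow> 'e set \<Rightarrow> ('g, 'e) lie_data" where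
  "exp_group G \<aa> = G\<lparr>carrier := lie_exp G ` \<aa>\<rparr>"

definition continuous_group_action ::
    "('g, 'e::euclidean_space) lie_data \<Rightarrow> ('g \<Rightarrow> 'm::topological_space \<Rightarrow> 'm) \<Rightarrow> bool" where
  "continuous_group_action G act \<longleftrightarrow>
     group_action G UNIV act \<and>
     continuous_map (prod_topology (gtop G) euclidean) euclidean (\<lambda>(g, x). act g x)"


section \<open>Orthogonality in a subspace with a scalar product\<close>

definition perp_in :: "'e::real_vector set \<Rightarrow> ('e \<Rightarrow> 'e \<Rightarrow> real) \<Rightarrow> 'e set \<Rightarrow> 'e set" where
  "perp_in V ip W = {v\<in>V. \<forall>w\<in>W. ip v w = 0}"

definition orth_proj :: "('e::real_vector \<Rightarrow> 'e \<Rightarrow> real) \<Rightarrow> 'e set \<Rightarrow> 'e \<Rightarrow> 'e" where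
  "orth_proj ip W v = (THE w. w \<in> W \<and> (\<forall>u\<in>W. ip (v - w) u = 0))"


section \<open>Kempf-Ness functions\<close>

definition gradient_map ::
    "('g, 'e::euclidean_space) lie_data \<Rightarrow> 'e set \<Rightarrow> ('e \<Rightarrow> 'e \<Rightarrow> real) \<Rightarrow>
     ('m \<Rightarrow> 'g \<Rightarrow> real) \<Rightarrow> 'm \<Rightarrow> 'e" where
  "gradient_map G \<aa> ip \<Psi> x =
     (THE v. v \<in> \<aa> \<and> (\<forall>\<xi>\<in>\<aa>. ip v \<xi> = deriv (\<lambda>t. \<Psi> x (lie_exp G (t *\<^sub>R \<xi>))) 0))"

text \<open>Kempf-Ness functions for \<open>(M, A, {e})\<close>, with \<open>A = exp(\<aa>)\<close> and \<open>M\<close> the whole type \<open>'m\<close>. Only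
  the values of \<open>\<Psi> x\<close> on \<open>A\<close> matter. Smoothness on \<open>A\<close> is taken in the global chart
  \<open>exp : \<aa> \<rightarrow> A\<close>. Invariance under the maximal compact subgroup \<open>{e}\<close> of \<open>A\<close> is void.\<close>

definition kempf_ness ::
    "('g, 'e::euclidean_space) lie_data \<Rightarrow> ('g \<Rightarrow> 'm::topological_space \<Rightarrow> 'm) \<Rightarrow> 'e set \<Rightarrow>
     ('e \<Rightarrow> 'e \<Rightarrow> real) \<Rightarrow> ('m \<Rightarrow> 'g \<Rightarrow> real) \<Rightarrow> bool" where
  "kempf_ness G act \<aa> ip \<Psi> \<longleftrightarrow>
     (\<forall>x. smooth_on_subspace \<aa> (\<Psi> x \<circ> lie_exp G)) \<and>
     (\<forall>x. \<forall>\<xi>\<in>\<aa>. \<forall>t. (deriv ^^ 2) (\<lambda>s. \<Psi> x (lie_exp G (s *\<^sub>R \<xi>))) t \<ge> 0) \<and>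
     (\<forall>x. \<forall>\<xi>\<in>\<aa>.
        (deriv ^^ 2) (\<lambda>s. \<Psi> x (lie_exp G (s *\<^sub>R \<xi>))) 0 = 0 \<longleftrightarrow>
        range (\<lambda>s::real. lie_exp G (s *\<^sub>R \<xi>)) \<subseteq> stabilizer (exp_group G \<aa>) act x) \<and>
     (\<forall>x. \<forall>g\<in>carrier (exp_group G \<aa>). \<forall>h\<in>carrier (exp_group G \<aa>).
        \<Psi> x g + \<Psi> (act g x) h = \<Psi> x (h \<otimes>\<^bsub>G\<^esub> g)) \<and>
     continuous_on UNIV (gradient_map G \<aa> ip \<Psi>)"

end

theory Submission
  imports Defs
begin

text \<open>In the chart \<open>exp\<close>, the cocycle condition identifies \<open>\<FF>(exp(v) x)\<close> with the gradient at \<open>v\<close> of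
  the single function \<open>f(v) = \<Psi>(x, exp v)\<close> on \<open>\<aa>\<close>. This function is convex, affine along \<open>\<aa>\<^sub>x\<close> and
  strictly convex along every other direction. So everything reduces to a strictly convex
  differentiable function \<open>f\<close> on the vector space \<open>P = \<aa>\<^sub>x\<^sup>\<bottom>\<close>: a vector \<open>c\<close> is a gradient of \<open>f\<close> if
  and only if \<open>f - \<langle>c, \<cdot>\<rangle>\<close> attains its minimum, which by strict convexity happens if and only if
  \<open>f - \<langle>c, \<cdot>\<rangle>\<close> grows at least linearly, and this condition on \<open>c\<close> is visibly open and convex.\<close>

section \<open>Scalar products on a subspace\<close>

text \<open>Precomposing both arguments with the orthogonal projection \<open>p\<close> of the
  ambient inner product onto \<open>V\<close> makes \<open>b\<close> bilinear on the whole type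
  without changing it on \<open>V\<close>. In finite dimension the result is bounded, which supplies
  continuity and norm estimates.\<close>

lemma symmetric_bilinear_on_extend:
  fixes V :: "'e::euclidean_space set"
  assumes V: "subspace V" and b: "symmetric_bilinear_on V b"
  obtains \<beta> where "bounded_bilinear \<beta>" "\<And>u v. u \<in> V \<Longrightarrow> v \<in> V \<Longrightarrow> \<beta> u v = b u v"
proof -
  obtain B where B: "B \<subseteq> V" "pairwise orthogonal B" "\<And>u. u \<in> B \<Longrightarrow> norm u = 1"
      "independent B" "span B = V"
    using orthonormal_basis_subspace[OF V] by metis
  have fin: "finite B" using B(4) independent_imp_finite by blast
  define p where "p u = (\<Sum>e\<in>B. (u \<bullet> e) *\<^sub>R e)" for u :: 'e
  have pV: "p u \<in> V" for u
    unfolding p_def using B(1) by (intro subspace_sum[OF V] subspace_scale[OF V]) auto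
  have lin: "linear p"
    unfolding p_def by (intro linearI) (simp_all add: inner_left_distrib scaleR_left_distrib
        sum.distrib scaleR_sum_right)
  have p_id: "p u = u" if "u \<in> V" for u
  proof -
    have "p u = id u"
    proof (rule linear_eq_on_span[OF lin linear_id, of B])
      fix e assume e: "e \<in> B"
      have "(e \<bullet> e') *\<^sub>R e' = (if e' = e then e else 0)" if "e' \<in> B" for e'
        using B(2,3) e that by (auto simp: pairwise_def orthogonal_def norm_eq_1)
      then show "p e = id e" using e fin by (simp add: p_def)
    qed (use that B(5) in auto)
    then show ?thesis by simp
  qed
  have sym: "b u v = b v u" if "u \<in> V" "v \<in> V" for u v
    using b that by (auto simp: symmetric_bilinear_on_def)
  have add: "b (u + v) w = b u w + b v w" if "u \<in> V" "v \<in> V" "w \<in> V" for u v w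
    using b that by (auto simp: symmetric_bilinear_on_def)
  have scale: "b (c *\<^sub>R u) v = c * b u v" if "u \<in> V" "v \<in> V" for u v c
    using b that by (auto simp: symmetric_bilinear_on_def)
  have l: "linear (\<lambda>u. b (p u) (p v))" for v
    by (intro linearI) (simp_all add: linear_add[OF lin] linear_scale[OF lin] pV add scale)
  have "bilinear (\<lambda>u v. b (p u) (p v))"
    unfolding bilinear_def using l sym[OF pV pV] by simp
  then have "bounded_bilinear (\<lambda>u v. b (p u) (p v))"
    by (simp add: bilinear_conv_bounded_bilinear)
  then show ?thesis using that p_id by simp
qed

text \<open>\<open>T u\<close> encodes the functional \<open>\<beta> u\<close> by its values on an
  orthonormal basis of \<open>W\<close>. Positivity makes \<open>T\<close> injective on
  \<open>W\<close>, a dimension count makes it surjective onto \<open>W\<close>, and the preimage of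
  the encoding of \<open>l\<close> is the representing vector.\<close>

lemma riesz_on_subspace:
  fixes W :: "'e::euclidean_space set"
  assumes W: "subspace W" and \<beta>: "bounded_bilinear \<beta>"
    and pos: "\<And>u. u \<in> W \<Longrightarrow> u \<noteq> 0 \<Longrightarrow> \<beta> u u > (0::real)"
    and l: "linear l"
  shows "\<exists>!u. u \<in> W \<and> (\<forall>v\<in>W. \<beta> u v = l v)"
proof -
  interpret \<beta>: bounded_bilinear \<beta> by fact
  obtain B where B: "B \<subseteq> W" "pairwise orthogonal B" "\<And>u. u \<in> B \<Longrightarrow> norm u = 1"
      "independent B" "span B = W"
    using orthonormal_basis_subspace[OF W] by metis
  have fin: "finite B" using B(4) independent_imp_finite by blast
  define T where "T u = (\<Sum>e\<in>B. \<beta> u e *\<^sub>R e)" for u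
  have lin: "linear T"
    unfolding T_def by (intro linearI) (simp_all add: \<beta>.add_left \<beta>.scaleR_left
        scaleR_left_distrib sum.distrib scaleR_sum_right)
  have coeff: "\<beta> u v = l' v" if "T u = (\<Sum>e\<in>B. l' e *\<^sub>R e)" "linear l'" "v \<in> W" for u v l'
  proof (rule linear_eq_on_span[of "\<beta> u" l' B])
    show "linear (\<beta> u)" using \<beta>.bounded_linear_right bounded_linear.linear by blast
    fix e assume e: "e \<in> B"
    have "(\<Sum>e\<in>B. (\<beta> u e - l' e) *\<^sub>R e) = 0"
      using that(1) by (simp add: T_def scaleR_left_diff_distrib sum_subtractf)
    then show "\<beta> u e = l' e"
      using B(4) fin e independentD[OF B(4) fin order_refl] by fastforce
  qed (use that B(5) in auto)
  have uniq: "u = 0" if "u \<in> W" "\<And>v. v \<in> W \<Longrightarrow> \<beta> u v = 0" for u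
    using pos[of u] that by force
  have inj: "inj_on T (span W)"
    unfolding linear_inj_on_iff_eq_0[OF lin subspace_span]
  proof (intro ballI impI)
    fix u assume "u \<in> span W" "T u = 0"
    then show "u = 0"
      using uniq[of u] coeff[of u "\<lambda>_. 0"] span_eq_iff[THEN iffD2, OF W]
      by (simp add: linear_zero)
  qed
  have TW: "T ` W = W"
  proof (rule subspace_dim_equal)
    show "subspace (T ` W)" using lin W by (rule linear_subspace_image)
    show "T ` W \<subseteq> W"
      unfolding T_def using B(1) by (auto intro!: subspace_sum[OF W] subspace_scale[OF W])
    show "dim W \<le> dim (T ` W)" using dim_image_eq[OF lin inj] by simp
  qed (fact W)
  have "(\<Sum>e\<in>B. l e *\<^sub>R e) \<in> W"
    using B(1) by (intro subspace_sum[OF W] subspace_scale[OF W]) auto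
  then obtain u where u: "u \<in> W" "T u = (\<Sum>e\<in>B. l e *\<^sub>R e)"
    using TW by (metis imageE)
  show ?thesis
  proof (rule ex1I[of _ u])
    show "u \<in> W \<and> (\<forall>v\<in>W. \<beta> u v = l v)" using u coeff l by blast
    then show "w = u" if "w \<in> W \<and> (\<forall>v\<in>W. \<beta> w v = l v)" for w
      using uniq[of "w - u"] that subspace_diff[OF W] by (simp add: \<beta>.diff_left)
  qed
qed

section \<open>Gradients of strictly convex functions\<close>

text \<open>Strict convexity is encoded to first order, as \<open>f\<close> lying strictly above its
  tangents along \<open>P\<close>, so that no second derivatives enter here.\<close>

locale strictly_convex_gradient =
  fixes P :: "'e::euclidean_space set" and \<beta> :: "'e \<Rightarrow> 'e \<Rightarrow> real"
    and f :: "'e \<Rightarrow> real" and D :: "'e \<Rightarrow> 'e"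
  assumes P: "subspace P" and bilin: "bounded_bilinear \<beta>"
    and pos: "\<And>u. u \<in> P \<Longrightarrow> u \<noteq> 0 \<Longrightarrow> \<beta> u u > 0"
    and cont: "continuous_on P f"
    and D_in: "\<And>v. v \<in> P \<Longrightarrow> D v \<in> P"
    and grad: "\<And>v \<xi>. v \<in> P \<Longrightarrow> \<xi> \<in> P \<Longrightarrow>
      ((\<lambda>t. f (v + t *\<^sub>R \<xi>)) has_real_derivative \<beta> (D v) \<xi>) (at 0)"
    and strict: "\<And>v \<xi>. v \<in> P \<Longrightarrow> \<xi> \<in> P \<Longrightarrow> \<xi> \<noteq> 0 \<Longrightarrow> f v + \<beta> (D v) \<xi> < f (v + \<xi>)"
begin

sublocale \<beta>: bounded_bilinear \<beta> by (rule bilin)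

lemma convex_ineq: "v \<in> P \<Longrightarrow> \<xi> \<in> P \<Longrightarrow> f v + \<beta> (D v) \<xi> \<le> f (v + \<xi>)"
  using strict[of v \<xi>] by (cases "\<xi> = 0") (auto simp: \<beta>.zero_right)

text \<open>Subtracting the tangent direction at \<open>v\<close> leaves a function \<open>h\<close>
  with a strict minimum at \<open>v\<close>. Compactness of the unit sphere around \<open>v\<close>
  gives a gap \<mu>, and convexity along each ray from \<open>v\<close> turns the gap into a slope
  of at least \<mu> beyond the sphere.\<close>

lemma gradient_imp_linear_growth:
  assumes v: "v \<in> P"
  shows "\<exists>m>0. \<exists>R. \<forall>u\<in>P. m * norm u - R \<le> f u - \<beta> (D v) u"
proof -
  define h where "h u = f u - \<beta> (D v) u" for u
  have h_strict: "h v < h (v + \<xi>)" if "\<xi> \<in> P" "\<xi> \<noteq> 0" for \<xi>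
    using strict[OF v that] by (simp add: h_def \<beta>.add_right)
  define S where "S = P \<inter> sphere 0 1"
  have "compact S" unfolding S_def using closed_subspace[OF P] by (simp add: closed_Int_compact)
  obtain \<mu> where \<mu>: "\<mu> > 0" "\<And>\<xi>. \<xi> \<in> S \<Longrightarrow> \<mu> \<le> h (v + \<xi>) - h v"
  \<comment> \<open>\<open>S\<close> is empty when \<open>P = {0}\<close>; any positive \<mu> then
    serves.\<close>
  proof (cases "S = {}")
    case False
    have "continuous_on S (\<lambda>\<xi>. h (v + \<xi>) - h v)"
      unfolding h_def using v subspace_add[OF P]
      by (intro continuous_intros \<beta>.continuous_on continuous_on_compose2[OF cont])
         (auto simp: S_def)
    from continuous_attains_inf[OF \<open>compact S\<close> False this]
    obtain \<xi> where \<xi>: "\<xi> \<in> S" "\<And>\<eta>. \<eta> \<in> S \<Longrightarrow> h (v + \<xi>) - h v \<le> h (v + \<eta>) - h v" by blast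
    then have "h v < h (v + \<xi>)" by (intro h_strict) (auto simp: S_def)
    then show ?thesis using that[of "h (v + \<xi>) - h v"] \<xi>(2) by simp
  qed (use that[of 1] in auto)
  have growth: "h v + \<mu> * norm \<xi> - \<mu> \<le> h (v + \<xi>)" if \<xi>: "\<xi> \<in> P" for \<xi>
  proof (cases "norm \<xi> \<le> 1")
    case True
    have "h v \<le> h (v + \<xi>)" using h_strict[OF \<xi>] by (cases "\<xi> = 0") auto
    moreover have "\<mu> * norm \<xi> \<le> \<mu>" using True \<mu>(1) by (simp add: mult_left_le)
    ultimately show ?thesis by linarith
  next
    case False
    define s where "s = norm \<xi>"
    define \<eta> where "\<eta> = (1 / s) *\<^sub>R \<xi>"
    have s: "s > 1" using False by (simp add: s_def)
    have \<eta>: "\<eta> \<in> P" "\<eta> \<in> S" "\<xi> = s *\<^sub>R \<eta>"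
      using \<xi> s subspace_scale[OF P] by (auto simp: \<eta>_def S_def s_def)
    \<comment> \<open>\<open>w\<close> is where the ray from \<open>v\<close> to
      \<open>v + \<xi>\<close> crosses the unit sphere around \<open>v\<close>, and \<open>g\<close>
      is the slope of \<open>h\<close> there along \<eta>. The tangent at \<open>w\<close>, followed
      back to \<open>v\<close>, gives \<open>\<mu> \<le> g\<close>; followed forward to
      \<open>v + \<xi>\<close>, it gives the growth.\<close>
    define w where "w = v + \<eta>"
    have w: "w \<in> P" unfolding w_def using v \<eta>(1) by (rule subspace_add[OF P])
    define g where "g = \<beta> (D w) \<eta> - \<beta> (D v) \<eta>"
    have along: "h w + c * g \<le> h (w + c *\<^sub>R \<eta>)" for c
      using convex_ineq[OF w subspace_scale[OF P \<eta>(1), of c]]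
      by (simp add: h_def g_def \<beta>.add_right \<beta>.scaleR_right algebra_simps)
    have "\<mu> \<le> h w - h v" using \<mu>(2)[OF \<eta>(2)] by (simp add: w_def)
    also have "\<dots> \<le> g" using along[of "-1"] by (simp add: w_def)
    finally have "(s - 1) * \<mu> \<le> (s - 1) * g" using s by simp
    moreover have "w + (s - 1) *\<^sub>R \<eta> = v + \<xi>" by (simp add: w_def \<eta>(3) algebra_simps)
    ultimately have "h w + (s - 1) * \<mu> \<le> h (v + \<xi>)" using along[of "s - 1"] by simp
    moreover have "h v < h w" using \<mu>(2)[OF \<eta>(2)] \<mu>(1) by (simp add: w_def)
    ultimately show ?thesis by (simp add: s_def[symmetric] algebra_simps)
  qed
  \<comment> \<open>Recentring the bound from \<open>v\<close> to the origin changes only the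
    additive constant.\<close>
  have "\<mu> * norm u - (\<mu> * norm v + \<mu> - h v) \<le> h u" if "u \<in> P" for u
  proof -
    have "\<mu> * norm u \<le> \<mu> * (norm v + norm (u - v))"
      using \<mu>(1) norm_triangle_sub[of u v] by simp
    then show ?thesis using growth[OF subspace_diff[OF P that v]] by (simp add: algebra_simps)
  qed
  then show ?thesis using \<mu>(1) unfolding h_def by blast
qed

text \<open>Linear growth confines the minimisation to a compact ball, so a minimiser
  \<open>u\<close> over \<open>P\<close> exists. There all directional derivatives along
  \<open>P\<close> vanish, which forces \<open>D u = c\<close>.\<close>

lemma linear_growth_imp_gradient:
  assumes c: "c \<in> P" and m: "m > 0" and growth: "\<And>u. u \<in> P \<Longrightarrow> m * norm u - R \<le> f u - \<beta> c u"
  shows "c \<in> D ` P"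
proof -
  define h where "h u = f u - \<beta> c u" for u
  \<comment> \<open>Beyond radius \<open>(h 0 + R) / m\<close> the growth bound exceeds
    \<open>h 0\<close>. The maximum with \<open>0\<close> keeps the origin in the ball, so the
    minimum over the ball is at most \<open>h 0\<close>.\<close>
  define r where "r = max 0 ((h 0 + R) / m)"
  have "compact (P \<inter> cball 0 r)" using closed_subspace[OF P] by (simp add: closed_Int_compact)
  moreover have "P \<inter> cball 0 r \<noteq> {}" using subspace_0[OF P] by (auto simp: r_def)
  moreover have "continuous_on (P \<inter> cball 0 r) h"
    unfolding h_def
    by (intro continuous_intros \<beta>.continuous_on continuous_on_subset[OF cont]) auto
  ultimately obtain u where u: "u \<in> P" "\<And>w. w \<in> P \<inter> cball 0 r \<Longrightarrow> h u \<le> h w"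
    using continuous_attains_inf by (metis IntD1)
  have min: "h u \<le> h w" if w: "w \<in> P" for w
  proof (cases "norm w \<le> r")
    case False
    then have "(h 0 + R) / m < norm w" by (simp add: r_def)
    then have "h 0 + R < m * norm w" using m by (simp add: field_simps)
    moreover have "h u \<le> h 0" using u(2)[of 0] subspace_0[OF P] by (simp add: r_def)
    ultimately show ?thesis using growth[OF w] by (simp add: h_def)
  qed (use u(2) w in auto)
  have zero: "\<beta> (D u) \<xi> - \<beta> c \<xi> = 0" if \<xi>: "\<xi> \<in> P" for \<xi>
  proof (rule DERIV_local_min)
    have "((\<lambda>t. f (u + t *\<^sub>R \<xi>) - (\<beta> c u + t * \<beta> c \<xi>)) has_real_derivative
        \<beta> (D u) \<xi> - \<beta> c \<xi>) (at 0)"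
      by (rule derivative_eq_intros grad[OF u(1) \<xi>] refl | simp)+
    then show "((\<lambda>t. h (u + t *\<^sub>R \<xi>)) has_real_derivative \<beta> (D u) \<xi> - \<beta> c \<xi>) (at 0)"
      by (simp add: h_def \<beta>.add_right \<beta>.scaleR_right)
    show "\<forall>t. \<bar>0 - t\<bar> < 1 \<longrightarrow> h (u + 0 *\<^sub>R \<xi>) \<le> h (u + t *\<^sub>R \<xi>)"
      using min subspace_add[OF P u(1) subspace_scale[OF P \<xi>]] by simp
  qed simp
  \<comment> \<open>The difference is \<beta>-orthogonal to \<open>P\<close>, hence to itself, and
    positivity makes it zero.\<close>
  have "D u - c \<in> P" using D_in u(1) c subspace_diff[OF P] by blast
  then have "D u - c = 0"
    using zero[of "D u - c"] pos[of "D u - c"] by (force simp: \<beta>.diff_left)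
  then show ?thesis using u(1) by auto
qed

lemma gradient_image_eq:
  "D ` P = {c\<in>P. \<exists>m>0. \<exists>R. \<forall>u\<in>P. m * norm u - R \<le> f u - \<beta> c u}"
  using gradient_imp_linear_growth linear_growth_imp_gradient D_in by blast

text \<open>The weights that combine \<open>c\<close> and \<open>d\<close> also combine their growth
  rates and offsets, and \<open>s + t = 1\<close> restores the coefficient of
  \<open>f\<close>.\<close>

lemma convex_gradient_image: "convex (D ` P)"
proof (rule convexI)
  fix c d and s t :: real
  assume st: "0 \<le> s" "0 \<le> t" "s + t = 1" and "c \<in> D ` P" "d \<in> D ` P"
  then obtain m R n Q where c: "c \<in> P" "m > 0" "\<And>u. u \<in> P \<Longrightarrow> m * norm u - R \<le> f u - \<beta> c u"
    and d: "d \<in> P" "n > 0" "\<And>u. u \<in> P \<Longrightarrow> n * norm u - Q \<le> f u - \<beta> d u"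
    unfolding gradient_image_eq by blast
  show "s *\<^sub>R c + t *\<^sub>R d \<in> D ` P"
  proof (rule linear_growth_imp_gradient)
    show "s *\<^sub>R c + t *\<^sub>R d \<in> P"
      using c(1) d(1) by (intro subspace_add[OF P] subspace_scale[OF P])
    show "s * m + t * n > 0"
      using st c(2) d(2) by (cases "s = 0") (auto intro: add_pos_nonneg)
    fix u assume u: "u \<in> P"
    have "s * (m * norm u - R) + t * (n * norm u - Q) \<le> s * (f u - \<beta> c u) + t * (f u - \<beta> d u)"
      using st c(3)[OF u] d(3)[OF u] by (intro add_mono mult_left_mono)
    also have "\<dots> = (s + t) * f u - \<beta> (s *\<^sub>R c + t *\<^sub>R d) u"
      by (simp add: \<beta>.add_left \<beta>.scaleR_left algebra_simps)
    finally show "(s * m + t * n) * norm u - (s * R + t * Q) \<le> f u - \<beta> (s *\<^sub>R c + t *\<^sub>R d) u"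
      using st(3) by (simp add: algebra_simps)
  qed
qed

text \<open>Moving \<open>c\<close> by \<delta> changes \<open>\<beta> c u\<close> by at most
  \<open>C * norm \<delta> * norm u\<close>, so within radius \<open>m / (2 * C)\<close> half of the
  growth rate survives.\<close>

lemma openin_gradient_image: "openin (top_of_set P) (D ` P)"
  unfolding openin_euclidean_subtopology_iff
proof (intro conjI ballI)
  show "D ` P \<subseteq> P" using D_in by blast
  fix c assume "c \<in> D ` P"
  then obtain m R where c: "c \<in> P" "m > 0" "\<And>u. u \<in> P \<Longrightarrow> m * norm u - R \<le> f u - \<beta> c u"
    unfolding gradient_image_eq by blast
  obtain C where C: "C > 0" "\<And>u v. norm (\<beta> u v) \<le> norm u * norm v * C"
    using \<beta>.pos_bounded by blast
  have "d \<in> D ` P" if d: "d \<in> P" "dist d c < m / (2 * C)" for d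
  proof (rule linear_growth_imp_gradient)
    fix u assume u: "u \<in> P"
    have "C * norm (d - c) \<le> m / 2" using d(2) C(1) by (simp add: dist_norm field_simps)
    then have "C * norm (d - c) * norm u \<le> m / 2 * norm u" by (rule mult_right_mono) simp
    moreover have "\<beta> d u - \<beta> c u \<le> C * norm (d - c) * norm u"
      using C(2)[of "d - c" u] by (simp add: \<beta>.diff_left mult_ac)
    ultimately show "m / 2 * norm u - R \<le> f u - \<beta> d u" using c(3)[OF u] by simp
  qed (use d c in auto)
  then show "\<exists>e>0. \<forall>d\<in>P. dist d c < e \<longrightarrow> d \<in> D ` P"
    using C(1) c(2) by (intro exI[of _ "m / (2 * C)"]) auto
qed

end

section \<open>Smooth functions along lines\<close>

lemma smooth_on_UNIV_has_derivative:
  assumes "smooth_on UNIV g"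
  shows "(g has_derivative frechet_derivative g (at v)) (at v)"
proof -
  have "Ck_on (Suc 0) UNIV g" using assms unfolding smooth_on_def by blast
  then show ?thesis by (simp add: differentiable_on_def frechet_derivative_works)
qed

lemma smooth_on_UNIV_frechet_derivative:
  assumes "smooth_on UNIV g"
  shows "smooth_on UNIV (\<lambda>v. frechet_derivative g (at v) \<xi>)"
  unfolding smooth_on_def
proof
  fix k
  have "Ck_on (Suc k) UNIV g" using assms unfolding smooth_on_def by blast
  then show "Ck_on k UNIV (\<lambda>v. frechet_derivative g (at v) \<xi>)" by simp
qed

lemma smooth_on_UNIV_line_derivative:
  fixes g :: "'e::euclidean_space \<Rightarrow> real"
  assumes "smooth_on UNIV g"
  shows "((\<lambda>t. g (v + t *\<^sub>R \<xi>)) has_real_derivative frechet_derivative g (at (v + t *\<^sub>R \<xi>)) \<xi>) (at t)"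
proof -
  let ?D = "frechet_derivative g (at (v + t *\<^sub>R \<xi>))"
  have D: "(g has_derivative ?D) (at (v + t *\<^sub>R \<xi>))"
    using assms by (rule smooth_on_UNIV_has_derivative)
  have "((\<lambda>t. g (v + t *\<^sub>R \<xi>)) has_derivative (\<lambda>h. ?D (h *\<^sub>R \<xi>))) (at t)"
    by (rule has_derivative_compose[where f = "\<lambda>t. v + t *\<^sub>R \<xi>", OF _ D])
       (auto intro!: derivative_eq_intros)
  moreover have "?D (h *\<^sub>R \<xi>) = h * ?D \<xi>" for h
    using linear_scale[OF has_derivative_linear[OF D]] by simp
  ultimately show ?thesis by (simp add: has_field_derivative_def mult_commute_abs)
qed

text \<open>The mean value theorem writes the increment over [0, 1] as \<phi>' at some
  \<open>z > 0\<close>, and \<phi>' is strictly increasing.\<close>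

lemma strict_convex_ineq_of_deriv2_pos:
  fixes \<phi> :: "real \<Rightarrow> real"
  assumes d1: "\<And>t. (\<phi> has_real_derivative \<phi>' t) (at t)"
    and d2: "\<And>t. (\<phi>' has_real_derivative \<phi>'' t) (at t)" and pos: "\<And>t. \<phi>'' t > 0"
  shows "\<phi> 0 + \<phi>' 0 < \<phi> 1"
proof -
  obtain z where z: "0 < z" "\<phi> 1 - \<phi> 0 = (1 - 0) * \<phi>' z"
    using MVT2[of 0 1 \<phi> \<phi>'] d1 by auto
  have "\<phi>' 0 < \<phi>' z" by (rule DERIV_pos_imp_increasing[OF z(1)]) (use d2 pos in blast)
  then show ?thesis using z(2) by simp
qed

section \<open>Convex cocycles over the action of a vector group\<close>

text \<open>This is the Kempf-Ness setting read in the chart \<open>exp\<close>: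
  \<open>\<alpha> v\<close> stands for the action of \<open>exp v\<close>, and
  \<open>\<psi> y v\<close> for the value of \<Psi> at \<open>y\<close> and \<open>exp v\<close>.
  Convexity is required only at time 0, but at every point \<open>y\<close>; the cocycle condition
  carries it along lines.\<close>

locale convex_cocycle =
  fixes V :: "'e::euclidean_space set" and ip :: "'e \<Rightarrow> 'e \<Rightarrow> real"
    and \<alpha> :: "'e \<Rightarrow> 'm \<Rightarrow> 'm" and \<psi> :: "'m \<Rightarrow> 'e \<Rightarrow> real" and x :: 'm
  assumes V: "subspace V" and ip: "scalar_product_on V ip"
    and \<alpha>_zero: "\<And>y. \<alpha> 0 y = y"
    and \<alpha>_add: "\<And>v w y. v \<in> V \<Longrightarrow> w \<in> V \<Longrightarrow> \<alpha> (v + w) y = \<alpha> v (\<alpha> w y)"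
    and smooth: "\<And>y. smooth_on_subspace V (\<psi> y)"
    and nonneg: "\<And>y \<xi>. \<xi> \<in> V \<Longrightarrow> (deriv ^^ 2) (\<lambda>s. \<psi> y (s *\<^sub>R \<xi>)) 0 \<ge> 0"
    and null: "\<And>y \<xi>. \<xi> \<in> V \<Longrightarrow>
      (deriv ^^ 2) (\<lambda>s. \<psi> y (s *\<^sub>R \<xi>)) 0 = 0 \<Longrightarrow> \<forall>s. \<alpha> (s *\<^sub>R \<xi>) y = y"
    and cocycle: "\<And>y v w. v \<in> V \<Longrightarrow> w \<in> V \<Longrightarrow> \<psi> y v + \<psi> (\<alpha> v y) w = \<psi> y (w + v)"
begin

definition stab :: "'e set" where
  "stab = {\<xi>\<in>V. \<forall>t::real. \<alpha> (t *\<^sub>R \<xi>) x = x}"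

definition F :: "'m \<Rightarrow> 'e" where
  "F y = (THE v. v \<in> V \<and> (\<forall>\<xi>\<in>V. ip v \<xi> = deriv (\<lambda>t. \<psi> y (t *\<^sub>R \<xi>)) 0))"

definition P :: "'e set" where
  "P = perp_in V ip stab"

text \<open>A choice of extension of \<open>ip\<close> beyond \<open>V\<close>, fixed so that the
  rules of \<open>bounded_bilinear\<close> apply; its values outside \<open>V\<close> are
  arbitrary.\<close>

definition \<beta> :: "'e \<Rightarrow> 'e \<Rightarrow> real" where
  "\<beta> = (SOME \<beta>. bounded_bilinear \<beta> \<and> (\<forall>u\<in>V. \<forall>v\<in>V. \<beta> u v = ip u v))"

lemma \<beta>: "bounded_bilinear \<beta>" "u \<in> V \<Longrightarrow> v \<in> V \<Longrightarrow> \<beta> u v = ip u v"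
proof -
  have "\<exists>\<beta>. bounded_bilinear \<beta> \<and> (\<forall>u\<in>V. \<forall>v\<in>V. \<beta> u v = ip u v)"
    using symmetric_bilinear_on_extend[OF V] ip unfolding scalar_product_on_def by metis
  from someI_ex[OF this] show "bounded_bilinear \<beta>" "u \<in> V \<Longrightarrow> v \<in> V \<Longrightarrow> \<beta> u v = ip u v"
    unfolding \<beta>_def by blast+
qed

sublocale \<beta>: bounded_bilinear \<beta> by (rule \<beta>(1))

lemma linear_\<beta>: "linear (\<beta> u)"
  using \<beta>.bounded_linear_right bounded_linear.linear by blast

lemma \<beta>_pos: "u \<in> V \<Longrightarrow> u \<noteq> 0 \<Longrightarrow> \<beta> u u > 0"
  using ip \<beta>(2) by (simp add: scalar_product_on_def)

lemma riesz:
  assumes "subspace W" "W \<subseteq> V" "linear l"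
  shows "\<exists>!u. u \<in> W \<and> (\<forall>v\<in>W. \<beta> u v = l v)"
  using assms by (intro riesz_on_subspace \<beta>(1) \<beta>_pos) auto

section \<open>Stabilizer directions, their orthogonal complement and the orbit\<close>

lemma \<alpha>_commute: "v \<in> V \<Longrightarrow> w \<in> V \<Longrightarrow> \<alpha> v (\<alpha> w y) = \<alpha> w (\<alpha> v y)"
  by (metis \<alpha>_add add.commute)

lemma subspace_stab: "subspace stab"
proof (rule subspaceI)
  show "0 \<in> stab" using subspace_0[OF V] by (simp add: stab_def \<alpha>_zero)
  show "\<xi> + \<eta> \<in> stab" if "\<xi> \<in> stab" "\<eta> \<in> stab" for \<xi> \<eta>
    using that V by (auto simp: stab_def scaleR_right_distrib \<alpha>_add subspace_add subspace_scale)
  show "c *\<^sub>R \<xi> \<in> stab" if "\<xi> \<in> stab" for c \<xi>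
    using that V by (auto simp: stab_def subspace_scale)
qed

lemma stab_subset: "stab \<subseteq> V"
  by (auto simp: stab_def)

lemma P_eq: "P = {v\<in>V. \<forall>w\<in>stab. \<beta> v w = 0}"
  using stab_subset by (auto simp: P_def perp_in_def \<beta>(2) subset_iff)

lemma P_subset: "P \<subseteq> V"
  by (auto simp: P_eq)

lemma subspace_P: "subspace P"
  using V by (intro subspaceI) (auto simp: P_eq subspace_0 subspace_add subspace_scale
      \<beta>.zero_left \<beta>.add_left \<beta>.scaleR_left)

text \<open>The acting group is abelian, so \<open>\<alpha> v\<close> can be moved past
  \<open>\<alpha> (s *\<^sub>R \<xi>)\<close> and cancelled: all points of the orbit have the same
  stabilizer directions.\<close>

lemma stab_of_translate:
  assumes "v \<in> V" "\<xi> \<in> V" "\<forall>s. \<alpha> (s *\<^sub>R \<xi>) (\<alpha> v x) = \<alpha> v x"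
  shows "\<xi> \<in> stab"
proof -
  have "\<alpha> (s *\<^sub>R \<xi>) x = x" for s
  proof -
    have s: "s *\<^sub>R \<xi> \<in> V" and v: "- v \<in> V"
      using assms V by (auto simp: subspace_scale subspace_neg)
    have cancel: "\<alpha> (- v) (\<alpha> v y) = y" for y
      using \<alpha>_add[OF v assms(1), of y] \<alpha>_zero by simp
    have "\<alpha> (s *\<^sub>R \<xi>) x = \<alpha> (- v) (\<alpha> (s *\<^sub>R \<xi>) (\<alpha> v x))"
      using \<alpha>_commute[OF s assms(1)] cancel by simp
    then show ?thesis using assms(3) cancel by simp
  qed
  then show ?thesis using assms(2) by (simp add: stab_def)
qed

text \<open>Subtracting from \<open>v\<close> its orthogonal projection \<open>w\<close> onto
  \<open>stab\<close>, obtained from Riesz representation, does not move the image of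
  \<open>x\<close>, because \<open>w\<close> fixes \<open>x\<close>.\<close>

lemma orbit_eq: "(\<lambda>v. \<alpha> v x) ` V = (\<lambda>v. \<alpha> v x) ` P"
proof (intro equalityI subsetI)
  fix y assume "y \<in> (\<lambda>v. \<alpha> v x) ` V"
  then obtain v where v: "v \<in> V" "y = \<alpha> v x" by blast
  obtain w where w: "w \<in> stab" "\<forall>u\<in>stab. \<beta> w u = \<beta> v u"
    using riesz[OF subspace_stab stab_subset linear_\<beta>] by blast
  have wV: "w \<in> V" using w(1) stab_subset by blast
  have "v - w \<in> P"
    using v(1) wV w(2) V by (simp add: P_eq subspace_diff \<beta>.diff_left)
  moreover have "\<alpha> w x = x" using w(1) by (auto simp: stab_def dest!: spec[of _ 1])
  then have "y = \<alpha> (v - w) x"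
    using v wV \<alpha>_add[of "v - w" w x] V by (simp add: subspace_diff)
  ultimately show "y \<in> (\<lambda>v. \<alpha> v x) ` P" by blast
qed (use P_subset in blast)

section \<open>Gradients and strict convexity along the orbit\<close>

lemma \<psi>_translate: "v \<in> V \<Longrightarrow> w \<in> V \<Longrightarrow> \<psi> (\<alpha> v y) w = \<psi> y (v + w) - \<psi> y v"
  using cocycle[of v w y] by (simp add: add.commute)

text \<open>The derivative at 0 of a smooth extension \<open>g\<close> is linear, so Riesz
  representation on \<open>V\<close> shows that the description defining \<open>F\<close> denotes a
  unique vector.\<close>

lemma F_in: "F y \<in> V"
  and F_derivative:
    "\<xi> \<in> V \<Longrightarrow> ((\<lambda>t. \<psi> y (t *\<^sub>R \<xi>)) has_real_derivative \<beta> (F y) \<xi>) (at 0)"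
proof -
  obtain g where g: "smooth_on UNIV g" "\<And>v. v \<in> V \<Longrightarrow> g v = \<psi> y v"
    using smooth unfolding smooth_on_subspace_def by blast
  have D: "((\<lambda>t. \<psi> y (t *\<^sub>R \<xi>)) has_real_derivative frechet_derivative g (at 0) \<xi>) (at 0)"
    if "\<xi> \<in> V" for \<xi>
    using smooth_on_UNIV_line_derivative[OF g(1), of 0 \<xi> 0] that V
    by (simp add: g(2) subspace_scale)
  have "linear (frechet_derivative g (at 0))"
    using smooth_on_UNIV_has_derivative[OF g(1)] has_derivative_linear by blast
  then have ex1: "\<exists>!u. u \<in> V \<and> (\<forall>v\<in>V. \<beta> u v = frechet_derivative g (at 0) v)"
    using riesz[OF V] by simp
  have eq: "u \<in> V \<and> (\<forall>v\<in>V. \<beta> u v = frechet_derivative g (at 0) v) \<longleftrightarrow>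
      u \<in> V \<and> (\<forall>\<xi>\<in>V. ip u \<xi> = deriv (\<lambda>t. \<psi> y (t *\<^sub>R \<xi>)) 0)" for u
    using DERIV_imp_deriv[OF D] \<beta>(2) by auto
  have F: "F y \<in> V \<and> (\<forall>v\<in>V. \<beta> (F y) v = frechet_derivative g (at 0) v)"
    using theI'[OF ex1] unfolding F_def eq[symmetric] .
  then show "F y \<in> V" by blast
  show "\<xi> \<in> V \<Longrightarrow> ((\<lambda>t. \<psi> y (t *\<^sub>R \<xi>)) has_real_derivative \<beta> (F y) \<xi>) (at 0)"
    using D[of \<xi>] F by auto
qed

text \<open>Up to an additive constant, \<psi> at \<open>\<alpha> v x\<close> is
  \<open>\<psi> x\<close> shifted by \<open>v\<close>. This makes \<open>F (\<alpha> v x)\<close>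
  the gradient of \<open>\<psi> x\<close> at \<open>v\<close>.\<close>

lemma F_translate_derivative:
  assumes "v \<in> V" "\<xi> \<in> V"
  shows "((\<lambda>t. \<psi> x (v + t *\<^sub>R \<xi>)) has_real_derivative \<beta> (F (\<alpha> v x)) \<xi>) (at 0)"
proof -
  have "\<psi> x (v + t *\<^sub>R \<xi>) = \<psi> (\<alpha> v x) (t *\<^sub>R \<xi>) + \<psi> x v" for t
    using assms V by (simp add: \<psi>_translate subspace_scale)
  then show ?thesis
    using DERIV_add[OF F_derivative[OF assms(2), of "\<alpha> v x"] DERIV_const[of "\<psi> x v"]] by simp
qed

text \<open>Computing \<open>\<psi> x (v + t \<xi>)\<close> in both orders shows that \<open>\<psi>\<close> along \<open>\<xi> \<in> stab\<close> is the same at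
  \<open>x\<close> and at \<open>\<alpha> v x\<close>.\<close>

lemma F_diff_in_P:
  assumes v: "v \<in> V"
  shows "F (\<alpha> v x) - F x \<in> P"
proof -
  have "\<beta> (F (\<alpha> v x)) \<xi> = \<beta> (F x) \<xi>" if \<xi>: "\<xi> \<in> stab" for \<xi>
  proof -
    have \<xi>V: "\<xi> \<in> V" using \<xi> stab_subset by blast
    have "\<psi> (\<alpha> v x) (t *\<^sub>R \<xi>) = \<psi> x (t *\<^sub>R \<xi>)" for t
      using \<psi>_translate[of v "t *\<^sub>R \<xi>" x] \<psi>_translate[of "t *\<^sub>R \<xi>" v x] v \<xi>V V \<xi>
      by (simp add: subspace_scale stab_def add.commute)
    then show ?thesis
      using DERIV_unique F_derivative[OF \<xi>V, of "\<alpha> v x"] F_derivative[OF \<xi>V, of x] by simp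
  qed
  then show ?thesis using F_in V by (simp add: P_eq subspace_diff \<beta>.diff_left)
qed

text \<open>The projection of \<open>v\<close> is the Riesz representative on \<open>P\<close> of
  the functional \<open>\<beta> v\<close>.\<close>

lemma orth_proj_P:
  assumes "v \<in> V"
  shows "orth_proj ip P v \<in> P" "u \<in> P \<Longrightarrow> \<beta> (orth_proj ip P v) u = \<beta> v u"
    and orth_proj_P_eqI: "w \<in> P \<Longrightarrow> (\<And>u. u \<in> P \<Longrightarrow> \<beta> w u = \<beta> v u) \<Longrightarrow> orth_proj ip P v = w"
proof -
  have eq: "w \<in> P \<and> (\<forall>u\<in>P. ip (v - w) u = 0) \<longleftrightarrow> w \<in> P \<and> (\<forall>u\<in>P. \<beta> w u = \<beta> v u)" for w
    using assms P_subset V by (auto simp: \<beta>(2)[symmetric] subset_iff subspace_diff \<beta>.diff_left)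
  have ex1: "\<exists>!w. w \<in> P \<and> (\<forall>u\<in>P. \<beta> w u = \<beta> v u)"
    by (rule riesz[OF subspace_P P_subset linear_\<beta>])
  show "orth_proj ip P v \<in> P" "u \<in> P \<Longrightarrow> \<beta> (orth_proj ip P v) u = \<beta> v u"
    using theI'[OF ex1] unfolding orth_proj_def eq by auto
  show "w \<in> P \<Longrightarrow> (\<And>u. u \<in> P \<Longrightarrow> \<beta> w u = \<beta> v u) \<Longrightarrow> orth_proj ip P v = w"
    unfolding orth_proj_def eq using ex1 by (intro the1_equality) auto
qed

text \<open>By the cocycle condition, the second derivative of \<open>\<psi> x\<close> at time
  \<open>t\<close> on the line through \<open>v\<close> along \<xi> is the one at time 0 seen from
  \<open>y = \<alpha> (v + t *\<^sub>R \<xi>) x\<close>. It is positive, since \<xi> does not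
  stabilize \<open>x\<close> and hence does not stabilize \<open>y\<close>.\<close>

lemma strictly_convex:
  assumes v: "v \<in> V" and \<xi>: "\<xi> \<in> V" "\<xi> \<notin> stab"
  shows "\<psi> x v + \<beta> (F (\<alpha> v x)) \<xi> < \<psi> x (v + \<xi>)"
proof -
  obtain g where g: "smooth_on UNIV g" "\<And>v. v \<in> V \<Longrightarrow> g v = \<psi> x v"
    using smooth unfolding smooth_on_subspace_def by blast
  define g' where "g' u = frechet_derivative g (at u) \<xi>" for u
  define \<phi> where "\<phi> t = g (v + t *\<^sub>R \<xi>)" for t
  define \<phi>' where "\<phi>' t = g' (v + t *\<^sub>R \<xi>)" for t
  define \<phi>'' where "\<phi>'' t = frechet_derivative g' (at (v + t *\<^sub>R \<xi>)) \<xi>" for t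
  have d1: "(\<phi> has_real_derivative \<phi>' t) (at t)" for t
    unfolding \<phi>_def \<phi>'_def g'_def by (rule smooth_on_UNIV_line_derivative[OF g(1)])
  have "smooth_on UNIV g'"
    unfolding g'_def by (rule smooth_on_UNIV_frechet_derivative[OF g(1)])
  then have d2: "(\<phi>' has_real_derivative \<phi>'' t) (at t)" for t
    unfolding \<phi>'_def \<phi>''_def by (rule smooth_on_UNIV_line_derivative)
  have inV: "v + t *\<^sub>R \<xi> \<in> V" for t using v \<xi>(1) V by (simp add: subspace_add subspace_scale)
  have \<phi>: "\<phi> t = \<psi> x (v + t *\<^sub>R \<xi>)" for t using g(2)[OF inV] by (simp add: \<phi>_def)
  have pos: "\<phi>'' t > 0" for t
  proof -
    define y where "y = \<alpha> (v + t *\<^sub>R \<xi>) x"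
    have "\<psi> y (s *\<^sub>R \<xi>) = \<phi> (s + t) - \<phi> t" for s
      using inV[of t] \<xi>(1) V
      by (simp add: y_def \<psi>_translate subspace_scale \<phi> scaleR_left_distrib add_ac)
    moreover have "((\<lambda>s. \<phi> (s + t) - \<phi> t) has_real_derivative \<phi>' (s + t)) (at s)" for s
      using DERIV_diff[OF d1[of "s + t", unfolded DERIV_shift] DERIV_const[of "\<phi> t"]] by simp
    \<comment> \<open>The first derivative is needed for all \<open>s\<close>, because
      \<open>deriv ^^ 2\<close> differentiates it again.\<close>
    ultimately have "deriv (\<lambda>s. \<psi> y (s *\<^sub>R \<xi>)) = (\<lambda>s. \<phi>' (s + t))"
      by (auto intro!: ext DERIV_imp_deriv)
    moreover have "deriv (\<lambda>s. \<phi>' (s + t)) 0 = \<phi>'' t"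
      using d2[of "0 + t", unfolded DERIV_shift] by (simp add: DERIV_imp_deriv)
    ultimately have "(deriv ^^ 2) (\<lambda>s. \<psi> y (s *\<^sub>R \<xi>)) 0 = \<phi>'' t"
      by (simp add: numeral_2_eq_2)
    moreover have "\<not> (\<forall>s. \<alpha> (s *\<^sub>R \<xi>) y = y)"
      using stab_of_translate[OF inV \<xi>(1)] \<xi>(2) by (auto simp: y_def)
    ultimately show ?thesis
      using nonneg[OF \<xi>(1), of y] null[OF \<xi>(1), of y] by force
  qed
  have "(\<phi> has_real_derivative \<beta> (F (\<alpha> v x)) \<xi>) (at 0)"
    using F_translate_derivative[OF v \<xi>(1)] by (simp add: \<phi>[abs_def])
  then have "\<phi>' 0 = \<beta> (F (\<alpha> v x)) \<xi>" using DERIV_unique d1 by blast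
  then show ?thesis using strict_convex_ineq_of_deriv2_pos[OF d1 d2 pos] by (simp add: \<phi>)
qed

text \<open>Restricting \<open>\<psi> x\<close> to \<open>P\<close> projects its gradient to
  \<open>P\<close>, as pairing with vectors of \<open>P\<close> does not see the remaining
  component. Strictness holds in every nonzero direction of \<open>P\<close>, because a vector in
  both \<open>P\<close> and \<open>stab\<close> is orthogonal to itself.\<close>

sublocale grad: strictly_convex_gradient P \<beta> "\<psi> x" "\<lambda>v. orth_proj ip P (F (\<alpha> v x))"
proof
  fix v \<xi> assume "v \<in> P" "\<xi> \<in> P"
  then have V: "v \<in> V" "\<xi> \<in> V" using P_subset by auto
  have \<beta>_eq: "\<beta> (orth_proj ip P (F (\<alpha> v x))) \<xi> = \<beta> (F (\<alpha> v x)) \<xi>"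
    using \<open>\<xi> \<in> P\<close> by (rule orth_proj_P(2)[OF F_in])
  show "((\<lambda>t. \<psi> x (v + t *\<^sub>R \<xi>)) has_real_derivative
      \<beta> (orth_proj ip P (F (\<alpha> v x))) \<xi>) (at 0)"
    using F_translate_derivative[OF V] by (simp add: \<beta>_eq)
  assume "\<xi> \<noteq> 0"
  then have "\<xi> \<notin> stab" using \<open>\<xi> \<in> P\<close> \<beta>_pos[of \<xi>] V by (force simp: P_eq)
  then show "\<psi> x v + \<beta> (orth_proj ip P (F (\<alpha> v x))) \<xi> < \<psi> x (v + \<xi>)"
    using strictly_convex[OF V] by (simp add: \<beta>_eq)
next
  obtain g where g: "smooth_on UNIV g" "\<And>v. v \<in> V \<Longrightarrow> g v = \<psi> x v"
    using smooth unfolding smooth_on_subspace_def by blast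
  have "Ck_on 0 UNIV g" using g(1) unfolding smooth_on_def by blast
  then have "continuous_on P g" using continuous_on_subset by auto
  then show "continuous_on P (\<psi> x)"
    using continuous_on_cong[of P P g "\<psi> x"] g(2) P_subset by blast
qed (use subspace_P \<beta>(1) \<beta>_pos P_subset orth_proj_P(1)[OF F_in] in auto)

text \<open>Differences of \<open>F\<close> along the orbit lie in \<open>P\<close>, so there
  \<open>F\<close> equals its projection plus the constant \<open>z\<close>, the component of
  \<open>F x\<close> orthogonal to \<open>P\<close>. The claims about \<open>F\<close> are
  translates by \<open>z\<close> of those about the projection.\<close>

theorem gradient_image_orbit:
  defines "Fx \<equiv> F ` (\<lambda>v. \<alpha> v x) ` V"
  shows "openin (top_of_set P) (orth_proj ip P ` Fx)" "convex (orth_proj ip P ` Fx)"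
    "openin (top_of_set ((+) (F x) ` P)) Fx" "convex Fx"
proof -
  define \<pi> where "\<pi> = orth_proj ip P"
  define z where "z = F x - \<pi> (F x)"
  have \<pi>_image: "\<pi> ` Fx = (\<lambda>v. \<pi> (F (\<alpha> v x))) ` P"
    unfolding Fx_def orbit_eq by (simp add: image_image)
  show op: "openin (top_of_set P) (orth_proj ip P ` Fx)"
    and cv: "convex (orth_proj ip P ` Fx)"
    using grad.openin_gradient_image grad.convex_gradient_image \<pi>_image
    by (simp_all add: \<pi>_def)
  have "F (\<alpha> v x) = z + \<pi> (F (\<alpha> v x))" if "v \<in> V" for v
  proof -
    let ?d = "F (\<alpha> v x) - F x"
    have "\<pi> (F (\<alpha> v x)) = \<pi> (F x) + ?d"
      unfolding \<pi>_def
    proof (rule orth_proj_P_eqI[OF F_in])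
      show "orth_proj ip P (F x) + ?d \<in> P"
        using orth_proj_P(1)[OF F_in] F_diff_in_P[OF that] by (rule subspace_add[OF subspace_P])
      show "\<beta> (orth_proj ip P (F x) + ?d) u = \<beta> (F (\<alpha> v x)) u" if "u \<in> P" for u
        using orth_proj_P(2)[OF F_in that] by (simp add: \<beta>.add_left \<beta>.diff_left)
    qed
    then show ?thesis by (simp add: z_def)
  qed
  then have Fx: "Fx = (+) z ` \<pi> ` Fx"
    unfolding Fx_def image_image by (intro image_cong) auto
  have "\<pi> (F x) \<in> P" unfolding \<pi>_def by (rule orth_proj_P(1)[OF F_in])
  \<comment> \<open>Translating \<open>P\<close> by its own element \<open>\<pi> (F x)\<close> gives
    \<open>P\<close> again, so \<open>F x\<close> and \<open>z\<close> define the same affine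
    subspace.\<close>
  then have "v \<in> (+) (\<pi> (F x)) ` P" if "v \<in> P" for v
    using subspace_diff[OF subspace_P that] by (intro image_eqI[of _ _ "v - \<pi> (F x)"]) auto
  with \<open>\<pi> (F x) \<in> P\<close> have "(+) (\<pi> (F x)) ` P = P"
    using subspace_add[OF subspace_P] by blast
  then have aff: "(+) (F x) ` P = (+) z ` P"
    using translation_assoc[of z "\<pi> (F x)" P] by (simp add: z_def)
  show "convex Fx" using cv Fx convex_translation by (metis \<pi>_def)
  have "openin (top_of_set ((+) z ` P)) ((+) z ` \<pi> ` Fx)"
    using homeomorphism_imp_open_map[OF homeomorphism_symD[OF homeomorphism_translation]] op
    by (simp add: \<pi>_def)
  then show "openin (top_of_set ((+) (F x) ` P)) Fx" using Fx aff by simp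
qed

end

section \<open>The gradient map on an orbit\<close>

theorem proposition2p1:
  fixes G :: "('g, 'e::euclidean_space) lie_data"
    and K :: "'g set" and \<pp> \<aa> :: "'e set"
    and ip :: "'e \<Rightarrow> 'e \<Rightarrow> real"
    and act :: "'g \<Rightarrow> 'm::t2_space \<Rightarrow> 'm"
    and \<Psi> :: "'m \<Rightarrow> 'g \<Rightarrow> real" and x :: 'm
  assumes "real_reductive_group G K \<pp>"
    and "\<not> compact_space (gtop G)"
    and "continuous_group_action G act"
    and "invariant_scalar_product G K \<pp> ip"
    and "\<aa> \<subseteq> \<pp>" and "abelian_subalgebra G \<aa>"
    and "subgroup (lie_exp G ` \<aa>) G"
    and "lie_exp G \<in> iso (additive_group \<aa>) (exp_group G \<aa>)"
    and "kempf_ness G act \<aa> ip \<Psi>"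
  shows "let F = gradient_map G \<aa> ip \<Psi>;
             Ax = orbit (exp_group G \<aa>) act x;
             \<aa>\<^sub>x = lie_algebra_of G \<aa> (stabilizer (exp_group G \<aa>) act x);
             P = perp_in \<aa> ip \<aa>\<^sub>x;
             \<pi> = orth_proj ip P
         in (openin (top_of_set P) (\<pi> ` F ` Ax) \<and> convex (\<pi> ` F ` Ax)) \<and>
            (openin (top_of_set ((+) (F x) ` P)) (F ` Ax) \<and> convex (F ` Ax))"
proof -
  let ?e = "lie_exp G"
  have A: "carrier (exp_group G \<aa>) = ?e ` \<aa>" by (simp add: exp_group_def)
  have V: "subspace \<aa>" using assms(6) by (simp add: abelian_subalgebra_def)
  interpret act: group_action G UNIV act
    using assms(3) by (simp add: continuous_group_action_def)
  interpret group G using act.group_hom by (simp add: group_hom_def)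
  have e_in: "?e v \<in> carrier G" if "v \<in> \<aa>" for v
    using subgroup.subset[OF assms(7)] that by blast
  have e_add: "?e (v + w) = ?e v \<otimes>\<^bsub>G\<^esub> ?e w" if "v \<in> \<aa>" "w \<in> \<aa>" for v w
    using assms(8) that by (auto simp: iso_def hom_def additive_group_def exp_group_def)
  \<comment> \<open>This follows from the homomorphism property by cancelling in
    \<open>?e 0 = ?e 0 \<otimes> ?e 0\<close>.\<close>
  have e_zero: "?e 0 = \<one>\<^bsub>G\<^esub>"
    using e_add[of 0 0] e_in[of 0] subspace_0[OF V] l_cancel_one' by auto
  have act_one: "act \<one>\<^bsub>G\<^esub> y = y" for y
    using act.id_eq_one by (metis UNIV_I restrict_apply')
  have stab: "?e v \<in> stabilizer (exp_group G \<aa>) act y \<longleftrightarrow> act (?e v) y = y" if "v \<in> \<aa>" for v y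
    using that by (auto simp: stabilizer_def A)
  have KN:
      "smooth_on_subspace \<aa> (\<lambda>v. \<Psi> y (?e v))"
      "\<xi> \<in> \<aa> \<Longrightarrow> (deriv ^^ 2) (\<lambda>s. \<Psi> y (?e (s *\<^sub>R \<xi>))) 0 \<ge> 0"
      "\<xi> \<in> \<aa> \<Longrightarrow> (deriv ^^ 2) (\<lambda>s. \<Psi> y (?e (s *\<^sub>R \<xi>))) 0 = 0 \<Longrightarrow>
         range (\<lambda>s::real. ?e (s *\<^sub>R \<xi>)) \<subseteq> stabilizer (exp_group G \<aa>) act y"
      "v \<in> \<aa> \<Longrightarrow> w \<in> \<aa> \<Longrightarrow> \<Psi> y (?e v) + \<Psi> (act (?e v) y) (?e w) = \<Psi> y (?e w \<otimes>\<^bsub>G\<^esub> ?e v)"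
    for y \<xi> v w
    using assms(9) unfolding kempf_ness_def A comp_def by blast+
  \<comment> \<open>The homomorphism \<open>exp\<close> turns products in \<open>A\<close> into sums
    in \<aa>, so the multiplicative action and cocycle become the additive ones of the
    locale.\<close>
  interpret C: convex_cocycle \<aa> ip "\<lambda>v. act (?e v)" "\<lambda>y v. \<Psi> y (?e v)" x
  proof
    show "subspace \<aa>" by (rule V)
    show "scalar_product_on \<aa> ip"
      using assms(4,5) unfolding invariant_scalar_product_def scalar_product_on_def
        symmetric_bilinear_on_def by (simp add: subset_iff)
    show "act (?e 0) y = y" for y by (simp add: e_zero act_one)
    show "act (?e (v + w)) y = act (?e v) (act (?e w) y)" if "v \<in> \<aa>" "w \<in> \<aa>" for v w y
      using that by (simp add: e_add act.composition_rule e_in)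
    show "\<forall>s. act (?e (s *\<^sub>R \<xi>)) y = y"
      if "\<xi> \<in> \<aa>" "(deriv ^^ 2) (\<lambda>s. \<Psi> y (?e (s *\<^sub>R \<xi>))) 0 = 0" for y \<xi>
      using KN(3)[OF that] stab subspace_scale[OF V that(1)] by blast
  qed (use KN in \<open>simp_all add: e_add\<close>)
  have F: "gradient_map G \<aa> ip \<Psi> = C.F"
    by (simp add: fun_eq_iff gradient_map_def C.F_def)
  have orb: "orbit (exp_group G \<aa>) act x = (\<lambda>v. act (?e v) x) ` \<aa>"
    by (auto simp: orbit_def A)
  have "lie_algebra_of G \<aa> (stabilizer (exp_group G \<aa>) act x) = C.stab"
    unfolding lie_algebra_of_def C.stab_def using stab subspace_scale[OF V] by blast
  then have P: "perp_in \<aa> ip (lie_algebra_of G \<aa> (stabilizer (exp_group G \<aa>) act x)) = C.P"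
    by (simp add: C.P_def)
  show ?thesis
    unfolding Let_def F orb P using C.gradient_image_orbit by blast
qed

end
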